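(* Let $n\ge 1$ be an integer, let $a<b$ be real numbers, and let $P_0,\dots,P_{n-1}$ and $g$ be continuous functions on $[a,b]$. Define, for $x,y\in[a,b]$, $$h(x,y)=-\sum_{k=0}^{n-1}P_k(x)\,\frac{(x-y)^{n-k-1}}{(n-k-1)!},$$ $$R(x,y)=h(x,y)+\sum_{r=2}^{\infty}\int_y^x dz_1\int_y^{z_1}dz_2\cdots\int_y^{z_{r-2}}dz_{r-1}\,h(x,z_1)\,h(z_1,z_2)\cdots h(z_{r-1},y),$$ $$T(x,y)=\frac{(x-y)^{n-1}}{(n-1)!}+\int_y^x dz\,\frac{(x-z)^{n-1}}{(n-1)!}\,R(z,y).$$ Then the Green's function for the inhomogeneous linear differential equation $$\Big(\partial_x^n+\sum_{k=0}^{n-1}P_k(x)\,\partial_x^k\Big)y(x)=g(x)$$ on $[a,b]$ with the boundary condition $\partial_x^i y(a)=0$ for $i=0,1,\dots,n-1$ is $$G(x,y)=\theta(x-y)\,T(x,y),$$ and the solution of this equation with this boundary condition is given, for $x\in[a,b]$, by $$y(x)=\int_a^b G(x,z)\,g(z)\,dz .$$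
   Context: Functions are complex-valued functions of a real variable. $\theta$ is the Heaviside step function: $\theta(t)=1$ for $t>0$ and $\theta(t)=0$ for $t<0$ (the value at $0$ is immaterial; take $\theta(0)=1$). Integrals $\int_y^x$ are oriented, so $\int_y^x=-\int_x^y$ when $x<y$. In the definition of $R$, for $r=2$ the term is $\int_y^x dz_1\,h(x,z_1)h(z_1,y)$. Green's function (causal Green's function): for $\mathcal{O}=\partial_x^n+\sum_{k=0}^{n-1}P_k(x)\partial_x^k$ on $[a,b]$ and the boundary condition $\partial_x^i y(a)=0$, $i=0,\dots,n-1$, it is the function $G(x,y)=T(x,y)\theta(x-y)$ on $[a,b]\times[a,b]$ where, for each fixed $y\in[a,b]$, $T(\cdot,y)$ is the $n$ times continuously differentiable function on $[a,b]$ with $\mathcal{O}(x,\partial_x)T(x,y)=0$, $(\partial_x^iT(x,y))|_{x=y}=0$ for $i=0,\dots,n-2$, and $(\partial_x^{n-1}T(x,y))|_{x=y}=1$. *)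

theory Defs
  imports "HOL-Analysis.Analysis"
begin

definition heaviside :: "real \<Rightarrow> complex" where
  "heaviside t = (if t \<ge> 0 then 1 else 0)"

text \<open>
  The derivatives are relative to the interval, hence one-sided at its endpoints; for
  \<open>a < b\<close> and arguments in \<open>{a..b}\<close> they depend only on the values of the function on \<open>{a..b}\<close>.
\<close>

definition nderiv :: "real \<Rightarrow> real \<Rightarrow> nat \<Rightarrow> (real \<Rightarrow> complex) \<Rightarrow> real \<Rightarrow> complex" where
  "nderiv a b k f = ((\<lambda>u x. vector_derivative u (at x within {a..b})) ^^ k) f"

definition Cn_on :: "nat \<Rightarrow> real \<Rightarrow> real \<Rightarrow> (real \<Rightarrow> complex) \<Rightarrow> bool" where
  "Cn_on n a b f \<longleftrightarrow>
     (\<forall>k<n. nderiv a b k f differentiable_on {a..b}) \<and> continuous_on {a..b} (nderiv a b n f)"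

definition diff_op ::
  "nat \<Rightarrow> (nat \<Rightarrow> real \<Rightarrow> complex) \<Rightarrow> real \<Rightarrow> real \<Rightarrow> (real \<Rightarrow> complex) \<Rightarrow> real \<Rightarrow> complex" where
  "diff_op n P a b f x = nderiv a b n f x + (\<Sum>k<n. P k x * nderiv a b k f x)"

definition is_solution ::
  "nat \<Rightarrow> (nat \<Rightarrow> real \<Rightarrow> complex) \<Rightarrow> (real \<Rightarrow> complex) \<Rightarrow> real \<Rightarrow> real \<Rightarrow> (real \<Rightarrow> complex) \<Rightarrow> bool" where
  "is_solution n P g a b f \<longleftrightarrow>
     Cn_on n a b f \<and> (\<forall>x\<in>{a..b}. diff_op n P a b f x = g x) \<and> (\<forall>i<n. nderiv a b i f a = 0)"

text \<open>
  The derivatives are those of \<open>\<lambda>x. T x y\<close> for fixed \<open>y\<close>. The exponent \<open>n - 1\<close> is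
  truncated subtraction on \<open>nat\<close>, so the following two notions are meant for \<open>n \<ge> 1\<close>.
\<close>

definition is_causal_kernel ::
  "nat \<Rightarrow> (nat \<Rightarrow> real \<Rightarrow> complex) \<Rightarrow> real \<Rightarrow> real \<Rightarrow> (real \<Rightarrow> real \<Rightarrow> complex) \<Rightarrow> bool" where
  "is_causal_kernel n P a b T \<longleftrightarrow>
     (\<forall>y\<in>{a..b}.
        Cn_on n a b (\<lambda>x. T x y) \<and>
        (\<forall>x\<in>{a..b}. diff_op n P a b (\<lambda>x. T x y) x = 0) \<and>
        (\<forall>i<n - 1. nderiv a b i (\<lambda>x. T x y) y = 0) \<and>
        nderiv a b (n - 1) (\<lambda>x. T x y) y = 1)"

definition is_Green_function ::
  "nat \<Rightarrow> (nat \<Rightarrow> real \<Rightarrow> complex) \<Rightarrow> real \<Rightarrow> real \<Rightarrow> (real \<Rightarrow> real \<Rightarrow> complex) \<Rightarrow> bool" where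
  "is_Green_function n P a b G \<longleftrightarrow>
     (\<exists>T. is_causal_kernel n P a b T \<and>
          (\<forall>x\<in>{a..b}. \<forall>y\<in>{a..b}. G x y = T x y * heaviside (x - y)))"

definition h_kernel :: "nat \<Rightarrow> (nat \<Rightarrow> real \<Rightarrow> complex) \<Rightarrow> real \<Rightarrow> real \<Rightarrow> complex" where
  "h_kernel n P x y =
     - (\<Sum>k<n. P k x * complex_of_real ((x - y) ^ (n - k - 1) / fact (n - k - 1)))"

text \<open>
  The accumulator \<open>c\<close> carries the factors already collected, so that
  \<open>nested_integral h m y x 1\<close> unfolds to the \<open>m\<close>-fold integral over \<open>z\<^sub>1\<close> from \<open>y\<close> to \<open>x\<close>,
  \<open>z\<^sub>2\<close> from \<open>y\<close> to \<open>z\<^sub>1\<close>, \dots, \<open>z\<^sub>m\<close> from \<open>y\<close> to \<open>z\<^sub>m\<^sub>-\<^sub>1\<close> of the product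
  \<open>h x z\<^sub>1 * h z\<^sub>1 z\<^sub>2 * \<dots> * h z\<^sub>m y\<close>. The integral \<open>LBINT z=y..x\<close> is oriented: it changes
  sign when its bounds are exchanged.
\<close>

primrec nested_integral ::
  "(real \<Rightarrow> real \<Rightarrow> complex) \<Rightarrow> nat \<Rightarrow> real \<Rightarrow> real \<Rightarrow> complex \<Rightarrow> complex" where
  "nested_integral h 0 y x c = c * h x y"
| "nested_integral h (Suc m) y x c =
     (LBINT z=ereal y..ereal x. nested_integral h m y z (c * h x z))"

definition R_term :: "nat \<Rightarrow> (nat \<Rightarrow> real \<Rightarrow> complex) \<Rightarrow> nat \<Rightarrow> real \<Rightarrow> real \<Rightarrow> complex" where
  "R_term n P r x y = nested_integral (h_kernel n P) (r - 1) y x 1"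

definition R_kernel :: "nat \<Rightarrow> (nat \<Rightarrow> real \<Rightarrow> complex) \<Rightarrow> real \<Rightarrow> real \<Rightarrow> complex" where
  "R_kernel n P x y = h_kernel n P x y + (\<Sum>r. R_term n P (r + 2) x y)"

definition T_kernel :: "nat \<Rightarrow> (nat \<Rightarrow> real \<Rightarrow> complex) \<Rightarrow> real \<Rightarrow> real \<Rightarrow> complex" where
  "T_kernel n P x y =
     complex_of_real ((x - y) ^ (n - 1) / fact (n - 1)) +
     (LBINT z=ereal y..ereal x.
        complex_of_real ((x - z) ^ (n - 1) / fact (n - 1)) * R_kernel n P z y)"

definition G_kernel :: "nat \<Rightarrow> (nat \<Rightarrow> real \<Rightarrow> complex) \<Rightarrow> real \<Rightarrow> real \<Rightarrow> complex" where
  "G_kernel n P x y = heaviside (x - y) * T_kernel n P x y"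

end

theory Submission
  imports Defs
begin

text \<open>
  The idea is to make the highest derivative the unknown. Write \<open>p\<^sub>j(x, z)\<close> for
  \<open>(x - z)\<^sup>j / j!\<close>. By Taylor's formula with integral remainder, a function \<open>f\<close> of class
  \<open>C\<^sup>n\<close> whose derivatives of order below \<open>n - 1\<close> vanish at \<open>y\<close> and whose derivative of order
  \<open>n - 1\<close> equals \<open>c\<close> there is
    \<open>f(x) = c p\<^sub>n\<^sub>-\<^sub>1(x, y) + \<integral> p\<^sub>n\<^sub>-\<^sub>1(x, z) u(z) dz\<close>, integrated from \<open>y\<close> to \<open>x\<close>,
  with \<open>u\<close> its derivative of order \<open>n\<close>; conversely, every continuous \<open>u\<close> gives such an \<open>f\<close>,
  and lowering the index of \<open>p\<close> gives its derivatives (\<open>Cn_on_power_integral\<close>). The kernel \<open>h\<close> of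
  the theorem is exactly what the lower-order terms of the operator produce, so the operator maps
  \<open>f\<close> to \<open>u(x) - (c h(x, y) + \<integral> h(x, z) u(z) dz)\<close> (\<open>diff_op_power_integral\<close>). The initial value
  problem has become a Volterra equation of the second kind for \<open>u\<close>.

  The series \<open>R\<close> is the sum of the iterated kernels of \<open>h\<close>. The factorial bound
  \<open>norm_iterated_kernel_le\<close> makes it converge uniformly on the square, so \<open>R\<close> is continuous and
  satisfies \<open>R = h + h \<star> R\<close>, where \<open>\<star>\<close> is the composition of kernels
  (\<open>resolvent_equation\<close>). Hence \<open>u = R(\<cdot>, y)\<close> with \<open>c = 1\<close> solves the homogeneous equation,
  and the corresponding \<open>f\<close> is \<open>T(\<cdot>, y)\<close>. For the inhomogeneous equation, \<open>c = 0\<close>, \<open>y = a\<close> and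
  \<open>u(x) = g(x) + \<integral> R(x, z) g(z) dz\<close>, integrated from \<open>a\<close> to \<open>x\<close>; exchanging the integrals over
  a triangle turns the resulting \<open>f\<close> into \<open>\<integral> T(x, z) g(z) dz\<close> (\<open>is_solution_T_integral\<close>).

  Uniqueness, both of \<open>T\<close> and of the solution, follows since the difference of two candidates has a
  highest derivative with \<open>u = \<integral> h u\<close>, and iterating this identity against the same factorial
  bound forces \<open>u = 0\<close> (\<open>volterra_homogeneous_eq_zero\<close>). The base point \<open>y\<close> can lie
  inside the interval, so the integrals and bounds are two-sided throughout.
\<close>

section \<open>Iterated one-sided derivatives\<close>

text \<open>
  A sequence of functions that are explicitly known to be successive derivatives. Exhibiting such a
  chain is how the choice operator inside \<^const>\<open>nderiv\<close> is avoided.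
\<close>

definition derivative_chain :: "real \<Rightarrow> real \<Rightarrow> nat \<Rightarrow> (nat \<Rightarrow> real \<Rightarrow> complex) \<Rightarrow> bool" where
  "derivative_chain a b n F \<longleftrightarrow>
     (\<forall>i<n. \<forall>x\<in>{a..b}. (F i has_vector_derivative F (Suc i) x) (at x within {a..b}))"

lemma nderiv_0 [simp]: "nderiv a b 0 f = f"
  by (simp add: nderiv_def)

lemma nderiv_Suc: "nderiv a b (Suc k) f x = vector_derivative (nderiv a b k f) (at x within {a..b})"
  by (simp add: nderiv_def)

text \<open>
  One-sided derivatives at the endpoints are unique because the interval is nondegenerate. Only the
  values of \<open>f\<close> on the interval enter, which later allows \<open>f\<close> to be replaced by any formula valid
  there.
\<close>

lemma nderiv_eq_chain:
  assumes "a < b" "derivative_chain a b n F" "\<And>x. x \<in> {a..b} \<Longrightarrow> f x = F 0 x"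
    and "k \<le> n" "x \<in> {a..b}"
  shows "nderiv a b k f x = F k x"
  using assms(4,5)
proof (induction k arbitrary: x)
  case (Suc k)
  have "(F k has_vector_derivative F (Suc k) x) (at x within {a..b})"
    using assms(2) Suc.prems by (simp add: derivative_chain_def)
  then have "(nderiv a b k f has_vector_derivative F (Suc k) x) (at x within {a..b})"
    by (rule has_vector_derivative_transform[rotated 2]) (use Suc in auto)
  then show ?case
    using vector_derivative_within_cbox[of a b x] \<open>a < b\<close> Suc.prems by (simp add: nderiv_Suc)
qed (use assms(3) in auto)

lemma Cn_on_chain:
  assumes "a < b" "derivative_chain a b n F" "\<And>x. x \<in> {a..b} \<Longrightarrow> f x = F 0 x"
    and "continuous_on {a..b} (F n)"
  shows "Cn_on n a b f"
  unfolding Cn_on_def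
proof (intro conjI allI impI)
  fix k assume "k < n"
  have "(nderiv a b k f has_vector_derivative F (Suc k) x) (at x within {a..b})"
    if "x \<in> {a..b}" for x
  proof (rule has_vector_derivative_transform[OF that])
    show "(F k has_vector_derivative F (Suc k) x) (at x within {a..b})"
      using assms(2) \<open>k < n\<close> that by (simp add: derivative_chain_def)
  qed (use nderiv_eq_chain[OF assms(1-3)] \<open>k < n\<close> in auto)
  then show "nderiv a b k f differentiable_on {a..b}"
    unfolding differentiable_on_def has_vector_derivative_def differentiable_def by blast
next
  show "continuous_on {a..b} (nderiv a b n f)"
    using assms(4) by (rule continuous_on_eq) (use nderiv_eq_chain[OF assms(1-3)] in auto)
qed

lemma derivative_chain_nderiv:
  assumes "Cn_on n a b f"
  shows "derivative_chain a b n (\<lambda>i. nderiv a b i f)"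
  using assms vector_derivative_works[of "nderiv a b _ f"]
  by (auto simp: derivative_chain_def Cn_on_def differentiable_on_def nderiv_Suc)

lemma Cn_on_diff:
  assumes "a < b" "Cn_on n a b f" "Cn_on n a b g"
  shows "Cn_on n a b (\<lambda>x. f x - g x)"
    and "\<And>k x. k \<le> n \<Longrightarrow> x \<in> {a..b} \<Longrightarrow>
           nderiv a b k (\<lambda>x. f x - g x) x = nderiv a b k f x - nderiv a b k g x"
proof -
  let ?F = "\<lambda>i x. nderiv a b i f x - nderiv a b i g x"
  have chain: "derivative_chain a b n ?F"
    using assms(2,3)[THEN derivative_chain_nderiv]
    by (auto simp: derivative_chain_def intro!: has_vector_derivative_diff)
  show "Cn_on n a b (\<lambda>x. f x - g x)"
    by (rule Cn_on_chain[OF \<open>a < b\<close> chain])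
      (use assms(2,3) in \<open>auto simp: Cn_on_def intro!: continuous_on_diff\<close>)
  show "nderiv a b k (\<lambda>x. f x - g x) x = nderiv a b k f x - nderiv a b k g x"
    if "k \<le> n" "x \<in> {a..b}" for k x
    by (rule nderiv_eq_chain[OF \<open>a < b\<close> chain]) (use that in auto)
qed

section \<open>Oriented integrals\<close>

lemma interval_integrable_within:
  fixes f :: "real \<Rightarrow> complex"
  assumes "continuous_on {a..b} f" "x \<in> {a..b}" "y \<in> {a..b}"
  shows "interval_lebesgue_integrable lborel (ereal y) (ereal x) f"
proof (cases "y \<le> x")
  case True
  then show ?thesis
    using assms by (intro interval_integrable_continuous_on) (auto intro: continuous_on_subset)
next
  case False
  then have "interval_lebesgue_integrable lborel (ereal x) (ereal y) f"
    using assms by (intro interval_integrable_continuous_on) (auto intro: continuous_on_subset)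
  then show ?thesis
    by (simp add: interval_integrable_endpoints_reverse)
qed

lemma interval_integral_cong_within:
  fixes f g :: "real \<Rightarrow> complex"
  assumes "\<And>z. z \<in> {a..b} \<Longrightarrow> f z = g z" "x \<in> {a..b}" "y \<in> {a..b}"
  shows "(LBINT z=ereal y..ereal x. f z) = (LBINT z=ereal y..ereal x. g z)"
  using assms by (intro interval_integral_cong) (auto simp: einterval_iff min_def max_def split: if_splits)

lemma interval_integral_has_derivative:
  fixes f :: "real \<Rightarrow> complex"
  assumes "continuous_on {a..b} f" "x \<in> {a..b}" "y \<in> {a..b}"
  shows "((\<lambda>x. LBINT z=ereal y..ereal x. f z) has_vector_derivative f x) (at x within {a..b})"
  using interval_integral_FTC2[of a y b f x] assms by auto

lemma segment_in_interval:
  fixes a b x y t :: real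
  assumes "x \<in> {a..b}" "y \<in> {a..b}" "t \<in> {0..1}"
  shows "y + t * (x - y) \<in> {a..b}"
proof -
  have "(1 - t) *\<^sub>R y + t *\<^sub>R x \<in> {a..b}"
    using assms by (intro convexD) (auto intro: convex_real_interval)
  then show ?thesis by (simp add: algebra_simps)
qed

text \<open>
  Rescaling to the unit interval does not distinguish \<open>y \<le> x\<close> from \<open>x \<le> y\<close> and fixes the domain of
  integration. The two-sided estimates and the joint continuity in both endpoints rest on this form.
\<close>

lemma interval_integral_unit_interval:
  fixes f :: "real \<Rightarrow> complex"
  assumes f: "continuous_on {a..b} f" and xy: "x \<in> {a..b}" "y \<in> {a..b}"
  shows "((\<lambda>t. (x - y) *\<^sub>R f (y + t * (x - y))) has_integral (LBINT z=ereal y..ereal x. f z)) {0..1}"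
proof -
  define W where "W = (\<lambda>u. LBINT z=ereal y..ereal u. f z)"
  define s where "s = (\<lambda>t. y + t * (x - y))"
  have s: "s t \<in> {a..b}" if "t \<in> {0..1}" for t
    unfolding s_def by (rule segment_in_interval[OF xy that])
  have "((\<lambda>t. (x - y) *\<^sub>R f (s t)) has_integral (W \<circ> s) 1 - (W \<circ> s) 0) {0..1}"
  proof (rule fundamental_theorem_of_calculus)
    fix t :: real assume t: "t \<in> {0..1}"
    show "(W \<circ> s has_vector_derivative (x - y) *\<^sub>R f (s t)) (at t within {0..1})"
    proof (rule vector_diff_chain_within)
      show "(s has_vector_derivative x - y) (at t within {0..1})"
        unfolding s_def by (auto intro!: derivative_eq_intros)
      show "(W has_vector_derivative f (s t)) (at (s t) within s ` {0..1})"
        unfolding W_def using interval_integral_has_derivative[OF f s[OF t] xy(2)]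
        by (rule has_vector_derivative_within_subset) (use s in auto)
    qed
  qed simp
  moreover have "W y = 0"
    by (simp add: W_def)
  ultimately show ?thesis
    by (simp add: s_def W_def)
qed

text \<open>
  The gain of one power and one factorial per integration is what makes the resolvent series
  converge, whatever the length of the interval.
\<close>

lemma norm_interval_integral_power_bound:
  fixes f :: "real \<Rightarrow> complex"
  assumes f: "continuous_on {a..b} f" and xy: "x \<in> {a..b}" "y \<in> {a..b}"
    and bound: "\<And>z. z \<in> {a..b} \<Longrightarrow> norm (f z) \<le> C * (\<bar>z - y\<bar> ^ m / fact m)"
  shows "norm (LBINT z=ereal y..ereal x. f z) \<le> C * (\<bar>x - y\<bar> ^ Suc m / fact (Suc m))"
proof -
  let ?D = "C * \<bar>x - y\<bar> ^ Suc m"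
  let ?f = "\<lambda>t. (x - y) *\<^sub>R f (y + t * (x - y))"
  have I: "(?f has_integral (LBINT z=ereal y..ereal x. f z)) {0..1}"
    by (rule interval_integral_unit_interval[OF f xy])
  \<comment> \<open>After rescaling, the bound on the integrand is a multiple of \<open>t ^ m / fact m\<close>.\<close>
  have g: "((\<lambda>t. ?D * (t ^ m / fact m)) has_integral ?D * (1 ^ Suc m / fact (Suc m)) - ?D * (0 ^ Suc m / fact (Suc m))) {0..1}"
  proof (rule fundamental_theorem_of_calculus)
    fix t :: real
    have "((\<lambda>t. ?D * (t ^ Suc m / fact (Suc m))) has_real_derivative ?D * (real (Suc m) * t ^ m / fact (Suc m))) (at t within {0..1})"
      by (rule derivative_eq_intros refl | simp)+
    moreover have "?D * (real (Suc m) * t ^ m / fact (Suc m)) = ?D * (t ^ m / fact m)"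
      by (simp add: field_simps del: of_nat_Suc)
    ultimately show "((\<lambda>t. ?D * (t ^ Suc m / fact (Suc m))) has_vector_derivative ?D * (t ^ m / fact m)) (at t within {0..1})"
      by (simp add: has_real_derivative_iff_has_vector_derivative)
  qed simp
  have "norm (integral {0..1} ?f) \<le> integral {0..1} (\<lambda>t. ?D * (t ^ m / fact m))"
  proof (rule integral_norm_bound_integral)
    fix t :: real assume t: "t \<in> {0..1}"
    have "norm (f (y + t * (x - y))) \<le> C * (\<bar>t * (x - y)\<bar> ^ m / fact m)"
      using bound[OF segment_in_interval[OF xy t]] by simp
    then have "\<bar>x - y\<bar> * norm (f (y + t * (x - y))) \<le> \<bar>x - y\<bar> * (C * (\<bar>t * (x - y)\<bar> ^ m / fact m))"
      by (rule mult_left_mono) simp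
    then show "norm (?f t) \<le> ?D * (t ^ m / fact m)"
      using t by (simp add: abs_mult power_mult_distrib mult_ac)
  qed (use I g in \<open>auto simp: has_integral_integrable\<close>)
  then show ?thesis
    unfolding integral_unique[OF I] integral_unique[OF g] by simp
qed

text \<open>
  Fubini's theorem for a continuous function on the compact triangle \<open>z \<le> w\<close>, extended by zero.
\<close>

lemma interval_integral_triangle_swap:
  fixes \<phi> :: "real \<Rightarrow> real \<Rightarrow> complex"
  assumes "a \<le> x" and \<phi>: "continuous_on ({a..x} \<times> {a..x}) (\<lambda>(w, z). \<phi> w z)"
  shows "(LBINT w=ereal a..ereal x. (LBINT z=ereal a..ereal w. \<phi> w z)) =
         (LBINT z=ereal a..ereal x. (LBINT w=ereal z..ereal x. \<phi> w z))"
proof -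
  define S where "S = {a..x} \<times> {a..x} \<inter> {p. snd p \<le> fst p}"
  define F where "F w z = indicator S (w, z) *\<^sub>R \<phi> w z" for w z
  have "closed {p :: real \<times> real. snd p \<le> fst p}"
    by (intro closed_Collect_le continuous_intros)
  then have "compact S"
    unfolding S_def by (intro compact_Int_closed compact_Times) auto
  then have "integrable lborel (\<lambda>p. indicator S p *\<^sub>R (case p of (w, z) \<Rightarrow> \<phi> w z))"
    using \<phi> by (intro borel_integrable_compact) (auto simp: S_def intro: continuous_on_subset)
  also have "(\<lambda>p. indicator S p *\<^sub>R (case p of (w, z) \<Rightarrow> \<phi> w z)) = case_prod F"
    by (auto simp: F_def)
  finally have "integrable (lborel \<Otimes>\<^sub>M lborel) (case_prod F)"
    by (simp only: lborel_prod)
  then have swap: "(LBINT z. LBINT w. F w z) = (LBINT w. LBINT z. F w z)"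
    by (rule lborel_pair.Fubini_integral)
  have "(LBINT w=ereal a..ereal x. (LBINT z=ereal a..ereal w. \<phi> w z)) =
        (LBINT w:{a..x}. (LBINT z=ereal a..ereal w. \<phi> w z))"
    using \<open>a \<le> x\<close> by (rule interval_integral_Icc)
  also have "\<dots> = (LBINT w. LBINT z. F w z)"
    unfolding set_lebesgue_integral_def
  proof (rule Bochner_Integration.integral_cong[OF refl])
    fix w
    show "indicator {a..x} w *\<^sub>R (LBINT z=ereal a..ereal w. \<phi> w z) = (LBINT z. F w z)"
    proof (cases "w \<in> {a..x}")
      case True
      then show ?thesis
        by (subst interval_integral_Icc)
           (auto simp: set_lebesgue_integral_def F_def S_def indicator_def intro!: Bochner_Integration.integral_cong)
    next
      case False
      then have "F w z = 0" for z by (auto simp: F_def S_def)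
      then show ?thesis using False by simp
    qed
  qed
  also have "\<dots> = (LBINT z. LBINT w. F w z)"
    by (rule swap[symmetric])
  also have "\<dots> = (LBINT z:{a..x}. (LBINT w=ereal z..ereal x. \<phi> w z))"
    unfolding set_lebesgue_integral_def
  proof (rule Bochner_Integration.integral_cong[OF refl])
    fix z
    show "(LBINT w. F w z) = indicator {a..x} z *\<^sub>R (LBINT w=ereal z..ereal x. \<phi> w z)"
    proof (cases "z \<in> {a..x}")
      case True
      then show ?thesis
        by (subst interval_integral_Icc)
           (auto simp: set_lebesgue_integral_def F_def S_def indicator_def intro!: Bochner_Integration.integral_cong)
    next
      case False
      then have "F w z = 0" for w by (auto simp: F_def S_def)
      then show ?thesis using False by simp
    qed
  qed
  also have "\<dots> = (LBINT z=ereal a..ereal x. (LBINT w=ereal z..ereal x. \<phi> w z))"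
    using \<open>a \<le> x\<close> by (rule interval_integral_Icc[symmetric])
  finally show ?thesis .
qed

section \<open>Volterra kernels and the resolvent\<close>

definition continuous_kernel :: "real \<Rightarrow> real \<Rightarrow> (real \<Rightarrow> real \<Rightarrow> complex) \<Rightarrow> bool" where
  "continuous_kernel a b k \<longleftrightarrow> continuous_on ({a..b} \<times> {a..b}) (\<lambda>(x, y). k x y)"

lemma continuous_kernel_compose:
  assumes "continuous_kernel a b k" "continuous_on S f" "continuous_on S g"
    and "f ` S \<subseteq> {a..b}" "g ` S \<subseteq> {a..b}"
  shows "continuous_on S (\<lambda>s. k (f s) (g s))"
proof -
  have "continuous_on S (\<lambda>s. case (f s, g s) of (x, y) \<Rightarrow> k x y)"
    by (rule continuous_on_compose2[OF assms(1)[unfolded continuous_kernel_def]])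
       (use assms in \<open>auto intro!: continuous_on_Pair\<close>)
  then show ?thesis by simp
qed

lemma continuous_kernel_sections:
  assumes "continuous_kernel a b k" "x \<in> {a..b}"
  shows "continuous_on {a..b} (k x)" "continuous_on {a..b} (\<lambda>z. k z x)"
  by (rule continuous_kernel_compose[OF assms(1)]; use assms(2) in auto)+

text \<open>
  Composition of kernels; iterating it yields the nested integrals in the series for \<open>R\<close>.
\<close>

definition volterra_product ::
  "(real \<Rightarrow> real \<Rightarrow> complex) \<Rightarrow> (real \<Rightarrow> real \<Rightarrow> complex) \<Rightarrow> real \<Rightarrow> real \<Rightarrow> complex" where
  "volterra_product k l x y = (LBINT z=ereal y..ereal x. k x z * l z y)"

lemma continuous_kernel_volterra_product:
  assumes k: "continuous_kernel a b k" and l: "continuous_kernel a b l"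
  shows "continuous_kernel a b (volterra_product k l)"
proof -
  let ?U = "{a..b} \<times> {a..b}"
  let ?s = "\<lambda>p t. snd p + t * (fst p - snd p)"
  let ?f = "\<lambda>p t. (fst p - snd p) *\<^sub>R (k (fst p) (?s p t) * l (?s p t) (snd p))"
  have *: "(?s p t) \<in> {a..b}" if "p \<in> ?U" "t \<in> {0..1}" for p and t :: real
    using segment_in_interval[of "fst p" a b "snd p" t] that by auto
  have "continuous_on (?U \<times> cbox 0 1) (\<lambda>q. (fst (fst q) - snd (fst q)) *\<^sub>R
          (k (fst (fst q)) (?s (fst q) (snd q)) * l (?s (fst q) (snd q)) (snd (fst q))))"
    by (intro continuous_on_scaleR continuous_on_mult continuous_kernel_compose[OF k]
          continuous_kernel_compose[OF l] continuous_intros; use * in force)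
  then have "continuous_on (?U \<times> cbox 0 1) (\<lambda>(p, t). ?f p t)"
    by (simp add: case_prod_unfold)
  then have "continuous_on ?U (\<lambda>p. integral (cbox 0 1) (?f p))"
    by (rule integral_continuous_on_param)
  moreover have "integral (cbox 0 1) (?f p) = volterra_product k l (fst p) (snd p)" if "p \<in> ?U" for p
  proof -
    have "continuous_on {a..b} (\<lambda>z. k (fst p) z * l z (snd p))"
      using that by (intro continuous_on_mult continuous_kernel_sections(1)[OF k]
        continuous_kernel_sections(2)[OF l]) auto
    from integral_unique[OF interval_integral_unit_interval[OF this, of "fst p" "snd p"]] that show ?thesis
      unfolding volterra_product_def box_real(2) by auto
  qed
  ultimately show ?thesis
    unfolding continuous_kernel_def by (auto simp: case_prod_unfold elim!: continuous_on_eq)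
qed

text \<open>
  Applying \<open>l\<close> and then \<open>k\<close> as Volterra operators based at \<open>a\<close> is the Volterra operator of their
  product: both sides integrate over the triangle \<open>a \<le> z \<le> w \<le> x\<close>.
\<close>

lemma volterra_product_assoc:
  assumes "continuous_kernel a b k" "continuous_kernel a b l" "continuous_on {a..b} g"
    and x: "x \<in> {a..b}"
  shows "(LBINT w=ereal a..ereal x. k x w * (LBINT z=ereal a..ereal w. l w z * g z)) =
         (LBINT z=ereal a..ereal x. volterra_product k l x z * g z)"
proof -
  have "(LBINT w=ereal a..ereal x. k x w * (LBINT z=ereal a..ereal w. l w z * g z)) =
        (LBINT w=ereal a..ereal x. (LBINT z=ereal a..ereal w. k x w * (l w z * g z)))"
    by simp
  also have "\<dots> = (LBINT z=ereal a..ereal x. (LBINT w=ereal z..ereal x. k x w * (l w z * g z)))"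
  proof (rule interval_integral_triangle_swap)
    have "continuous_on ({a..x} \<times> {a..x}) (\<lambda>p. k x (fst p) * (l (fst p) (snd p) * g (snd p)))"
      using x by (intro continuous_on_mult continuous_kernel_compose[OF assms(1)]
          continuous_kernel_compose[OF assms(2)] continuous_on_compose2[OF assms(3)]
          continuous_intros) auto
    then show "continuous_on ({a..x} \<times> {a..x}) (\<lambda>(w, z). k x w * (l w z * g z))"
      by (simp add: case_prod_unfold)
  qed (use x in auto)
  also have "\<dots> = (LBINT z=ereal a..ereal x. volterra_product k l x z * g z)"
    unfolding volterra_product_def
    by (simp flip: mult.assoc)
  finally show ?thesis .
qed

primrec iterated_kernel :: "(real \<Rightarrow> real \<Rightarrow> complex) \<Rightarrow> nat \<Rightarrow> real \<Rightarrow> real \<Rightarrow> complex" where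
  "iterated_kernel k 0 = k"
| "iterated_kernel k (Suc m) = volterra_product k (iterated_kernel k m)"

text \<open>
  The accumulator is a constant factor for all inner integrals, so it can be pulled out.
\<close>

lemma nested_integral_eq_iterated_kernel:
  "nested_integral k m y x c = c * iterated_kernel k m x y"
  by (induction m arbitrary: x c) (simp_all add: volterra_product_def mult.assoc)

lemma continuous_kernel_iterated:
  "continuous_kernel a b k \<Longrightarrow> continuous_kernel a b (iterated_kernel k m)"
  by (induction m) (simp_all add: continuous_kernel_volterra_product)

lemma continuous_kernel_bounded:
  assumes "continuous_kernel a b k"
  obtains M where "M \<ge> 0" "\<And>x y. x \<in> {a..b} \<Longrightarrow> y \<in> {a..b} \<Longrightarrow> norm (k x y) \<le> M"
proof -
  have "bounded ((\<lambda>(x, y). k x y) ` ({a..b} \<times> {a..b}))"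
    using assms unfolding continuous_kernel_def
    by (intro compact_imp_bounded compact_continuous_image compact_Times) auto
  then obtain M where "\<forall>v \<in> (\<lambda>(x, y). k x y) ` ({a..b} \<times> {a..b}). norm v \<le> M"
    unfolding bounded_iff by blast
  then show ?thesis
    by (intro that[of "max M 0"]) (auto simp: le_max_iff_disj)
qed

lemma volterra_step_bound:
  assumes k: "continuous_kernel a b k" and u: "continuous_on {a..b} u"
    and x: "x \<in> {a..b}" and y: "y \<in> {a..b}"
    and M: "M \<ge> 0" "\<And>x y. x \<in> {a..b} \<Longrightarrow> y \<in> {a..b} \<Longrightarrow> norm (k x y) \<le> M"
    and bound: "\<And>z. z \<in> {a..b} \<Longrightarrow> norm (u z) \<le> C * (\<bar>z - y\<bar> ^ m / fact m)"
  shows "norm (LBINT z=ereal y..ereal x. k x z * u z) \<le> M * C * (\<bar>x - y\<bar> ^ Suc m / fact (Suc m))"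
proof (rule norm_interval_integral_power_bound[OF _ x y])
  show "continuous_on {a..b} (\<lambda>z. k x z * u z)"
    using continuous_kernel_sections(1)[OF k x] u by (intro continuous_on_mult)
  fix z assume z: "z \<in> {a..b}"
  show "norm (k x z * u z) \<le> M * C * (\<bar>z - y\<bar> ^ m / fact m)"
    unfolding norm_mult mult.assoc
    by (rule mult_mono) (use M bound x z in auto)
qed

lemma norm_iterated_kernel_le:
  assumes k: "continuous_kernel a b k" and xy: "x \<in> {a..b}" "y \<in> {a..b}"
    and M: "M \<ge> 0" "\<And>x y. x \<in> {a..b} \<Longrightarrow> y \<in> {a..b} \<Longrightarrow> norm (k x y) \<le> M"
  shows "norm (iterated_kernel k m x y) \<le> M ^ Suc m * (\<bar>x - y\<bar> ^ m / fact m)"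
  using xy(1)
proof (induction m arbitrary: x)
  case (Suc m)
  show ?case
    using volterra_step_bound[OF k _ Suc.prems xy(2) M Suc.IH]
      continuous_kernel_sections(2)[OF continuous_kernel_iterated[OF k] xy(2)]
    by (simp add: volterra_product_def)
qed (use M xy in auto)

text \<open>
  Feeding the equation into itself \<open>m\<close> times bounds \<open>u x\<close> by the general term of a convergent
  exponential series, which tends to zero.
\<close>

lemma volterra_homogeneous_eq_zero:
  assumes k: "continuous_kernel a b k" and u: "continuous_on {a..b} u" and y: "y \<in> {a..b}"
    and eq: "\<And>x. x \<in> {a..b} \<Longrightarrow> u x = (LBINT z=ereal y..ereal x. k x z * u z)"
    and x: "x \<in> {a..b}"
  shows "u x = 0"
proof -
  obtain M where M: "M \<ge> 0" "\<And>x y. x \<in> {a..b} \<Longrightarrow> y \<in> {a..b} \<Longrightarrow> norm (k x y) \<le> M"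
    using continuous_kernel_bounded[OF k] by metis
  have "bounded (u ` {a..b})"
    using u by (intro compact_imp_bounded compact_continuous_image) auto
  then obtain C where C: "\<And>x. x \<in> {a..b} \<Longrightarrow> norm (u x) \<le> C"
    unfolding bounded_iff by blast
  have bound: "norm (u x) \<le> M ^ m * C * (\<bar>x - y\<bar> ^ m / fact m)" if "x \<in> {a..b}" for x m
    using that
  proof (induction m arbitrary: x)
    case (Suc m)
    show ?case
      using volterra_step_bound[OF k u Suc.prems y M Suc.IH] eq[OF Suc.prems] by (simp add: mult.assoc)
  qed (use C in auto)
  have "(\<lambda>m. C * (inverse (fact m) * (M * \<bar>x - y\<bar>) ^ m)) \<longlonglongrightarrow> C * 0"
    by (intro tendsto_mult tendsto_const summable_LIMSEQ_zero summable_exp)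
  moreover have "norm (u x) \<le> C * (inverse (fact m) * (M * \<bar>x - y\<bar>) ^ m)" for m
    using bound[OF x, of m] by (simp add: power_mult_distrib field_simps)
  ultimately have "norm (u x) \<le> C * 0"
    by (intro LIMSEQ_le_const) auto
  then show ?thesis by simp
qed

text \<open>
  The bounds on the iterated kernels are dominated, uniformly on the square, by the terms of the
  series of \<open>M * exp (M * (b - a))\<close>.
\<close>

lemma iterated_kernel_uniform_limit:
  assumes k: "continuous_kernel a b k"
  shows "uniform_limit ({a..b} \<times> {a..b}) (\<lambda>N (x, y). \<Sum>m<N. iterated_kernel k m x y)
           (\<lambda>(x, y). \<Sum>m. iterated_kernel k m x y) sequentially"
    and "x \<in> {a..b} \<Longrightarrow> y \<in> {a..b} \<Longrightarrow> summable (\<lambda>m. iterated_kernel k m x y)"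
proof -
  obtain M where M: "M \<ge> 0" "\<And>x y. x \<in> {a..b} \<Longrightarrow> y \<in> {a..b} \<Longrightarrow> norm (k x y) \<le> M"
    using continuous_kernel_bounded[OF k] by metis
  let ?B = "\<lambda>m. M * (inverse (fact m) * (M * (b - a)) ^ m)"
  have B: "norm (iterated_kernel k m x y) \<le> ?B m" if "x \<in> {a..b}" "y \<in> {a..b}" for m x y
  proof -
    have "norm (iterated_kernel k m x y) \<le> M ^ Suc m * (\<bar>x - y\<bar> ^ m / fact m)"
      by (rule norm_iterated_kernel_le[OF k that M])
    also have "\<dots> \<le> M ^ Suc m * ((b - a) ^ m / fact m)"
      by (intro mult_left_mono divide_right_mono power_mono) (use that M in auto)
    finally show ?thesis by (simp add: power_mult_distrib divide_inverse mult_ac)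
  qed
  have sB: "summable ?B"
    by (intro summable_mult summable_exp)
  have "uniform_limit ({a..b} \<times> {a..b}) (\<lambda>N p. \<Sum>m<N. iterated_kernel k m (fst p) (snd p))
           (\<lambda>p. \<Sum>m. iterated_kernel k m (fst p) (snd p)) sequentially"
    by (rule Weierstrass_m_test[OF _ sB]) (use B in auto)
  then show "uniform_limit ({a..b} \<times> {a..b}) (\<lambda>N (x, y). \<Sum>m<N. iterated_kernel k m x y)
           (\<lambda>(x, y). \<Sum>m. iterated_kernel k m x y) sequentially"
    by (simp add: case_prod_unfold)
  show "summable (\<lambda>m. iterated_kernel k m x y)" if "x \<in> {a..b}" "y \<in> {a..b}"
    by (rule summable_comparison_test'[OF sB]) (use B that in auto)
qed

definition resolvent_kernel :: "(real \<Rightarrow> real \<Rightarrow> complex) \<Rightarrow> real \<Rightarrow> real \<Rightarrow> complex" where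
  "resolvent_kernel k x y = (\<Sum>m. iterated_kernel k m x y)"

lemma continuous_kernel_sum_iterated:
  assumes k: "continuous_kernel a b k"
  shows "continuous_kernel a b (\<lambda>x y. \<Sum>m<N. iterated_kernel k m x y)"
  using continuous_kernel_iterated[OF k]
  by (auto simp: continuous_kernel_def case_prod_unfold intro!: continuous_on_sum)

lemma continuous_kernel_resolvent:
  assumes k: "continuous_kernel a b k"
  shows "continuous_kernel a b (resolvent_kernel k)"
  unfolding continuous_kernel_def resolvent_kernel_def
  by (rule uniform_limit_theorem[OF _ iterated_kernel_uniform_limit(1)[OF k]])
     (use continuous_kernel_sum_iterated[OF k] in \<open>auto simp: continuous_kernel_def\<close>)

text \<open>
  Multiplication by \<open>k\<close> shifts the series of iterated kernels by one term. For partial sums this is an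
  identity; uniform convergence carries it to the limit.
\<close>

lemma resolvent_equation:
  assumes k: "continuous_kernel a b k" and x: "x \<in> {a..b}" and y: "y \<in> {a..b}"
  shows "resolvent_kernel k x y = k x y + volterra_product k (resolvent_kernel k) x y"
proof -
  let ?R = "resolvent_kernel k" and ?S = "\<lambda>N x y. \<Sum>m<N. iterated_kernel k m x y"
  note kx = continuous_kernel_sections(1)[OF k x]
  note Ry = continuous_kernel_sections(2)[OF continuous_kernel_resolvent[OF k] y]
  note Sy = continuous_kernel_sections(2)[OF continuous_kernel_sum_iterated[OF k] y]
  note Iy = continuous_kernel_sections(2)[OF continuous_kernel_iterated[OF k] y]
  obtain M where M: "M \<ge> 0" "\<And>x y. x \<in> {a..b} \<Longrightarrow> y \<in> {a..b} \<Longrightarrow> norm (k x y) \<le> M"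
    using continuous_kernel_bounded[OF k] by metis
  have partial: "volterra_product k (?S N) x y = ?S (Suc N) x y - k x y" for N
  proof (induction N)
    case (Suc N)
    have "volterra_product k (?S (Suc N)) x y =
          (LBINT z=ereal y..ereal x. k x z * ?S N z y + k x z * iterated_kernel k N z y)"
      by (simp add: volterra_product_def distrib_left)
    also have "\<dots> = volterra_product k (?S N) x y + iterated_kernel k (Suc N) x y"
      by (subst interval_lebesgue_integral_add)
         (use kx Sy Iy x y in \<open>auto simp: volterra_product_def
            intro!: interval_integrable_within[of a b] continuous_on_mult\<close>)
    finally show ?case using Suc by simp
  qed (simp add: volterra_product_def)
  have "(\<lambda>N. volterra_product k (?S N) x y) \<longlonglongrightarrow> volterra_product k ?R x y"
  proof (rule LIMSEQ_I)
    fix e :: real assume "e > 0"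
    \<comment> \<open>The integral of the error is at most \<open>M * d * \<bar>x - y\<bar>\<close>; the added 1 covers \<open>M * \<bar>x - y\<bar> = 0\<close>.\<close>
    define d where "d = e / (M * \<bar>x - y\<bar> + 1)"
    have pos: "M * \<bar>x - y\<bar> + 1 > 0"
      using M(1) by (intro add_nonneg_pos) auto
    then have "d > 0" using \<open>e > 0\<close> by (simp add: d_def)
    then obtain N0 where N0: "\<And>N z. N \<ge> N0 \<Longrightarrow> z \<in> {a..b} \<Longrightarrow> norm (?S N z y - ?R z y) < d"
      using iterated_kernel_uniform_limit(1)[OF k] y
      unfolding uniform_limit_iff eventually_sequentially dist_norm resolvent_kernel_def
      by fastforce
    have "norm (volterra_product k (?S N) x y - volterra_product k ?R x y) < e" if "N \<ge> N0" for N
    proof -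
      have "volterra_product k (?S N) x y - volterra_product k ?R x y =
            (LBINT z=ereal y..ereal x. k x z * ?S N z y - k x z * ?R z y)"
        unfolding volterra_product_def
        by (subst interval_lebesgue_integral_diff)
          (use kx Sy Ry x y in \<open>auto intro!: interval_integrable_within[of a b] continuous_on_mult\<close>)
      also have "\<dots> = (LBINT z=ereal y..ereal x. k x z * (?S N z y - ?R z y))"
        by (simp add: right_diff_distrib)
      also have "norm \<dots> \<le> M * d * (\<bar>x - y\<bar> ^ Suc 0 / fact (Suc 0))"
        by (rule volterra_step_bound[OF k _ x y M])
          (use Sy Ry N0[OF that] in \<open>auto intro!: continuous_on_diff less_imp_le\<close>)
      also have "\<dots> = e * (M * \<bar>x - y\<bar>) / (M * \<bar>x - y\<bar> + 1)"
        by (simp add: d_def)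
      also have "\<dots> < e"
        using pos \<open>e > 0\<close> by (simp add: field_simps)
      finally show ?thesis .
    qed
    then show "\<exists>N0. \<forall>N\<ge>N0. norm (volterra_product k (?S N) x y - volterra_product k ?R x y) < e"
      by blast
  qed
  moreover have "(\<lambda>N. volterra_product k (?S N) x y) \<longlonglongrightarrow> ?R x y - k x y"
    unfolding partial resolvent_kernel_def
    by (intro tendsto_diff tendsto_const LIMSEQ_Suc summable_LIMSEQ
        iterated_kernel_uniform_limit(2)[OF k x y])
  ultimately show ?thesis
    using LIMSEQ_unique by fastforce
qed

section \<open>Taylor's formula and repeated integrals\<close>

definition power_kernel :: "nat \<Rightarrow> real \<Rightarrow> real \<Rightarrow> complex" where
  "power_kernel j x z = complex_of_real ((x - z) ^ j / fact j)"

lemma power_kernel_0 [simp]: "power_kernel 0 x z = 1"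
  by (simp add: power_kernel_def)

lemma power_kernel_Suc_diag [simp]: "power_kernel (Suc j) x x = 0"
  by (simp add: power_kernel_def)

lemma continuous_kernel_power: "continuous_kernel a b (power_kernel j)"
  unfolding continuous_kernel_def power_kernel_def case_prod_unfold
  by (intro continuous_intros) auto

lemma power_kernel_has_derivative_left:
  "((\<lambda>x. power_kernel (Suc j) x z) has_vector_derivative power_kernel j x z) (at x within S)"
proof -
  have "((\<lambda>x. (x - z) ^ Suc j / fact (Suc j)) has_real_derivative (x - z) ^ j / fact j) (at x within S)"
    by (rule derivative_eq_intros refl | simp add: field_simps del: of_nat_Suc)+
  then show ?thesis
    unfolding power_kernel_def by (intro has_vector_derivative_of_real) 
      (simp add: has_real_derivative_iff_has_vector_derivative)
qed

lemma power_kernel_has_derivative_right: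
  "((\<lambda>z. power_kernel (Suc j) x z) has_vector_derivative - power_kernel j x z) (at z within S)"
proof -
  have "((\<lambda>z. (x - z) ^ Suc j / fact (Suc j)) has_real_derivative - ((x - z) ^ j / fact j)) (at z within S)"
    by (rule derivative_eq_intros refl | simp add: field_simps del: of_nat_Suc)+
  then have "((\<lambda>z. complex_of_real ((x - z) ^ Suc j / fact (Suc j))) has_vector_derivative
      complex_of_real (- ((x - z) ^ j / fact j))) (at z within S)"
    by (intro has_vector_derivative_of_real) (simp add: has_real_derivative_iff_has_vector_derivative)
  then show ?thesis
    unfolding power_kernel_def by simp
qed

text \<open>
  In the Taylor polynomial at the moving centre \<open>t\<close>, the derivative of each weight cancels the
  derivative of the preceding coefficient, leaving only the last term. Integrating this from
  \<open>y\<close> to \<open>x\<close> gives Taylor's formula for either order of the two points.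
\<close>

lemma taylor_telescoping_derivative:
  assumes "derivative_chain a b (Suc m) F" "t \<in> {a..b}"
  shows "((\<lambda>t. \<Sum>i<Suc m. power_kernel i x t * F i t) has_vector_derivative
           power_kernel m x t * F (Suc m) t) (at t within {a..b})"
  using assms(1)
proof (induction m)
  case 0
  then show ?case
    using assms(2) by (simp add: derivative_chain_def)
next
  case (Suc m)
  have F: "(F (Suc m) has_vector_derivative F (Suc (Suc m)) t) (at t within {a..b})"
    using Suc.prems assms(2) by (auto simp: derivative_chain_def)
  have "((\<lambda>t. (\<Sum>i<Suc m. power_kernel i x t * F i t) + power_kernel (Suc m) x t * F (Suc m) t)
      has_vector_derivative power_kernel m x t * F (Suc m) t +
        (power_kernel (Suc m) x t * F (Suc (Suc m)) t + - power_kernel m x t * F (Suc m) t))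
      (at t within {a..b})"
    using Suc.prems
    by (intro has_vector_derivative_add has_vector_derivative_mult Suc.IH F
        power_kernel_has_derivative_right) (auto simp: derivative_chain_def)
  then show ?case by simp
qed

lemma taylor_integral_remainder:
  assumes chain: "derivative_chain a b n F" and "n \<ge> 1" and F: "continuous_on {a..b} (F n)"
    and x: "x \<in> {a..b}" and y: "y \<in> {a..b}"
  shows "F 0 x = (\<Sum>i<n. power_kernel i x y * F i y) +
           (LBINT z=ereal y..ereal x. power_kernel (n - 1) x z * F n z)"
proof -
  obtain m where n: "n = Suc m" using \<open>n \<ge> 1\<close> by (cases n) auto
  let ?S = "\<lambda>t. \<Sum>i<Suc m. power_kernel i x t * F i t"
  have sub: "{min y x..max y x} \<subseteq> {a..b}" using x y by auto
  have "(LBINT z=ereal y..ereal x. power_kernel m x z * F (Suc m) z) = ?S x - ?S y"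
  proof (rule interval_integral_FTC_finite)
    show "continuous_on {min y x..max y x} (\<lambda>z. power_kernel m x z * F (Suc m) z)"
      using F sub continuous_kernel_sections(1)[OF continuous_kernel_power x]
      unfolding n by (intro continuous_on_mult) (rule continuous_on_subset; blast)+
    show "(?S has_vector_derivative power_kernel m x t * F (Suc m) t) (at t within {min y x..max y x})"
      if "min y x \<le> t" "t \<le> max y x" for t
      by (rule has_vector_derivative_within_subset[OF taylor_telescoping_derivative sub])
        (use chain sub that in \<open>auto simp: n\<close>)
  qed
  \<comment> \<open>At the centre \<open>x\<close> all weights but the zeroth vanish.\<close>
  moreover have "?S x = F 0 x"
    by (simp only: sum.lessThan_Suc_shift) simp
  ultimately show ?thesis
    by (simp add: n)
qed

primrec repeated_integral :: "real \<Rightarrow> (real \<Rightarrow> complex) \<Rightarrow> nat \<Rightarrow> real \<Rightarrow> complex" where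
  "repeated_integral y u 0 = u"
| "repeated_integral y u (Suc j) = (\<lambda>x. LBINT z=ereal y..ereal x. repeated_integral y u j z)"

lemma repeated_integral_has_derivative:
  assumes u: "continuous_on {a..b} u" and y: "y \<in> {a..b}"
  shows "continuous_on {a..b} (repeated_integral y u j)"
    and "x \<in> {a..b} \<Longrightarrow> (repeated_integral y u (Suc j) has_vector_derivative
           repeated_integral y u j x) (at x within {a..b})"
proof -
  have c: "continuous_on {a..b} (repeated_integral y u j)" for j
  proof (induction j)
    case (Suc j)
    show ?case
      using has_vector_derivative_continuous[OF interval_integral_has_derivative[OF Suc _ y]]
      by (simp add: continuous_on_eq_continuous_within)
  qed (simp add: u)
  show "continuous_on {a..b} (repeated_integral y u j)" by (rule c)
  show "x \<in> {a..b} \<Longrightarrow> (repeated_integral y u (Suc j) has_vector_derivative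
           repeated_integral y u j x) (at x within {a..b})"
    using interval_integral_has_derivative[OF c _ y] by simp
qed

text \<open>
  Cauchy's formula for repeated integration. It is Taylor's formula for the chain of repeated
  integrals, all of which vanish at \<open>y\<close> except the integrand itself. This avoids
  differentiating an integral whose integrand depends on its upper limit.
\<close>

lemma repeated_integral_Suc_eq:
  assumes u: "continuous_on {a..b} u" and y: "y \<in> {a..b}" and x: "x \<in> {a..b}"
  shows "repeated_integral y u (Suc j) x = (LBINT z=ereal y..ereal x. power_kernel j x z * u z)"
proof -
  let ?F = "\<lambda>i. repeated_integral y u (Suc j - i)"
  have "?F 0 x = (\<Sum>i<Suc j. power_kernel i x y * ?F i y) +
          (LBINT z=ereal y..ereal x. power_kernel (Suc j - 1) x z * ?F (Suc j) z)"
  proof (rule taylor_integral_remainder[OF _ _ _ x y])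
    show "derivative_chain a b (Suc j) ?F"
      using repeated_integral_has_derivative(2)[OF u y]
      by (auto simp: derivative_chain_def Suc_diff_le simp del: repeated_integral.simps(2))
  qed (auto simp: u)
  moreover have "?F i y = 0" if "i < Suc j" for i
    using that by (simp add: Suc_diff_le)
  ultimately show ?thesis
    by simp
qed

text \<open>
  The converse of Taylor's formula: any continuous \<open>u\<close> is the highest derivative of the function it
  represents, and each lower derivative has the same form with a weight of lower degree.
\<close>

lemma Cn_on_power_integral:
  assumes "a < b" "n \<ge> 1" and u: "continuous_on {a..b} u" and y: "y \<in> {a..b}"
    and f: "\<And>x. x \<in> {a..b} \<Longrightarrow> f x = c * power_kernel (n - 1) x y +
              (LBINT z=ereal y..ereal x. power_kernel (n - 1) x z * u z)"
  shows "Cn_on n a b f"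
    and "\<And>x. x \<in> {a..b} \<Longrightarrow> nderiv a b n f x = u x"
    and "\<And>k x. k < n \<Longrightarrow> x \<in> {a..b} \<Longrightarrow> nderiv a b k f x = c * power_kernel (n - k - 1) x y +
              (LBINT z=ereal y..ereal x. power_kernel (n - k - 1) x z * u z)"
proof -
  \<comment> \<open>At \<open>k = n\<close> the polynomial part has been differentiated away and \<open>u\<close> is left.\<close>
  define F where "F k x = (if k < n then c * power_kernel (n - k - 1) x y else 0) +
                            repeated_integral y u (n - k) x" for k x
  have "(F k has_vector_derivative F (Suc k) x) (at x within {a..b})"
    if "k < n" "x \<in> {a..b}" for k x
  proof -
    have "((\<lambda>x. c * power_kernel (n - k - 1) x y) has_vector_derivative
            (if Suc k < n then c * power_kernel (n - Suc k - 1) x y else 0)) (at x within {a..b})"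
    proof (cases "Suc k < n")
      case True
      then have "n - k - 1 = Suc (n - Suc k - 1)" by simp
      then show ?thesis
        using True by (auto intro!: has_vector_derivative_mult_right power_kernel_has_derivative_left)
    next
      case False
      then have "n - k - 1 = 0" by simp
      then show ?thesis using False by (simp del: diff_diff_left)
    qed
    moreover have "(repeated_integral y u (n - k) has_vector_derivative
        repeated_integral y u (n - Suc k) x) (at x within {a..b})"
      using repeated_integral_has_derivative(2)[OF u y \<open>x \<in> {a..b}\<close>, of "n - Suc k"] \<open>k < n\<close>
      by (simp add: Suc_diff_Suc del: repeated_integral.simps(2))
    ultimately show ?thesis
      using \<open>k < n\<close> has_vector_derivative_add unfolding F_def by fastforce
  qed
  then have chain: "derivative_chain a b n F"
    by (simp add: derivative_chain_def)
  have F: "F k x = c * power_kernel (n - k - 1) x y +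
             (LBINT z=ereal y..ereal x. power_kernel (n - k - 1) x z * u z)"
    if "k < n" "x \<in> {a..b}" for k x
    using repeated_integral_Suc_eq[OF u y \<open>x \<in> {a..b}\<close>, of "n - k - 1"] \<open>k < n\<close>
    by (simp add: F_def Suc_diff_Suc del: repeated_integral.simps(2))
  have F0: "f x = F 0 x" if "x \<in> {a..b}" for x
    using F[of 0 x] f[OF that] that \<open>n \<ge> 1\<close> by simp
  have Fn: "F n = u" by (simp add: F_def fun_eq_iff)
  note nd = nderiv_eq_chain[OF \<open>a < b\<close> chain F0]
  show "Cn_on n a b f"
    by (rule Cn_on_chain[OF \<open>a < b\<close> chain F0]) (use Fn u in auto)
  show "nderiv a b n f x = u x" if "x \<in> {a..b}" for x
    using nd[of n x] that Fn by simp
  show "nderiv a b k f x = c * power_kernel (n - k - 1) x y +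
              (LBINT z=ereal y..ereal x. power_kernel (n - k - 1) x z * u z)"
    if "k < n" "x \<in> {a..b}" for k x
    using nd[of k x] that F by simp
qed

section \<open>Reduction of the differential equation to a Volterra equation\<close>

text \<open>
  Up to sign, \<open>h\<close> is the lower-order part of the operator applied in \<open>x\<close> to
  \<^term>\<open>power_kernel (n - 1) x y\<close>, whose \<open>k\<close>-th derivative is the weight next to \<open>P k\<close>.
\<close>

lemma h_kernel_eq_power_kernel:
  "h_kernel n P x y = - (\<Sum>k<n. P k x * power_kernel (n - k - 1) x y)"
  by (simp add: h_kernel_def power_kernel_def)

lemma continuous_kernel_h:
  assumes "\<forall>k<n. continuous_on {a..b} (P k)"
  shows "continuous_kernel a b (h_kernel n P)"
  unfolding continuous_kernel_def h_kernel_eq_power_kernel case_prod_unfold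
  by (intro continuous_intros continuous_kernel_compose[OF continuous_kernel_power[of a b]]
      continuous_on_compose2[OF assms[rule_format]]) auto

lemma interval_integral_finite_sum:
  fixes f :: "'i \<Rightarrow> real \<Rightarrow> complex"
  assumes "finite I" "\<And>i. i \<in> I \<Longrightarrow> continuous_on {a..b} (f i)" "x \<in> {a..b}" "y \<in> {a..b}"
  shows "(LBINT z=ereal y..ereal x. (\<Sum>i\<in>I. f i z)) = (\<Sum>i\<in>I. LBINT z=ereal y..ereal x. f i z)"
  using assms(1,2)
proof (induction rule: finite_induct)
  case (insert i I)
  have "(LBINT z=ereal y..ereal x. f i z + (\<Sum>i\<in>I. f i z)) =
        (LBINT z=ereal y..ereal x. f i z) + (LBINT z=ereal y..ereal x. (\<Sum>i\<in>I. f i z))"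
    using insert.prems assms(3,4)
    by (intro interval_lebesgue_integral_add interval_integrable_within[of a b] continuous_on_sum) auto
  then show ?case using insert by simp
qed simp

text \<open>
  A differential equation for \<open>f\<close> thereby becomes a Volterra equation for \<open>u\<close>, to which the initial
  value \<open>c\<close> contributes the inhomogeneous term \<open>c * h_kernel n P x y\<close>.
\<close>

lemma diff_op_power_integral:
  assumes "a < b" "n \<ge> 1" and u: "continuous_on {a..b} u" and y: "y \<in> {a..b}"
    and f: "\<And>x. x \<in> {a..b} \<Longrightarrow> f x = c * power_kernel (n - 1) x y +
              (LBINT z=ereal y..ereal x. power_kernel (n - 1) x z * u z)"
    and x: "x \<in> {a..b}"
  shows "diff_op n P a b f x =
           u x - (c * h_kernel n P x y + (LBINT z=ereal y..ereal x. h_kernel n P x z * u z))"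
proof -
  note d = Cn_on_power_integral[OF assms(1-4) f]
  let ?p = "\<lambda>k. power_kernel (n - k - 1) x"
  have "(\<Sum>k<n. P k x * nderiv a b k f x) =
        (\<Sum>k<n. c * (P k x * ?p k y) + (LBINT z=ereal y..ereal x. P k x * (?p k z * u z)))"
    by (rule sum.cong) (use d(3) x in \<open>auto simp: distrib_left mult.left_commute\<close>)
  also have "\<dots> = c * (\<Sum>k<n. P k x * ?p k y) + (\<Sum>k<n. LBINT z=ereal y..ereal x. P k x * (?p k z * u z))"
    by (simp only: sum.distrib sum_distrib_left)
  also have "(\<Sum>k<n. LBINT z=ereal y..ereal x. P k x * (?p k z * u z)) =
             (LBINT z=ereal y..ereal x. (\<Sum>k<n. P k x * (?p k z * u z)))"
    by (rule interval_integral_finite_sum[of _ a b, symmetric])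
       (use x y u in \<open>auto intro!: continuous_on_mult continuous_kernel_sections(1)[OF continuous_kernel_power]\<close>)
  also have "\<dots> = (LBINT z=ereal y..ereal x. - (h_kernel n P x z * u z))"
    by (simp add: h_kernel_eq_power_kernel sum_distrib_right mult.assoc)
  finally show ?thesis
    using d(2)[of x] x by (simp add: diff_op_def h_kernel_eq_power_kernel interval_lebesgue_integral_uminus)
qed

text \<open>
  The initial point \<open>y\<close> may be interior, which is what uniqueness of the kernel \<open>T\<close> needs. The highest
  derivative of the difference solves the homogeneous Volterra equation, hence vanishes, and
  Taylor's formula then recovers the difference as zero.
\<close>

lemma ode_uniqueness:
  assumes "a < b" "n \<ge> 1" and P: "\<forall>k<n. continuous_on {a..b} (P k)"
    and f: "Cn_on n a b f" and g: "Cn_on n a b g" and y: "y \<in> {a..b}"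
    and op: "\<And>x. x \<in> {a..b} \<Longrightarrow> diff_op n P a b f x = diff_op n P a b g x"
    and init: "\<And>i. i < n \<Longrightarrow> nderiv a b i f y = nderiv a b i g y"
    and x: "x \<in> {a..b}"
  shows "f x = g x"
proof -
  define d where "d x = f x - g x" for x
  define u where "u = nderiv a b n d"
  have d: "Cn_on n a b d"
    "\<And>k x. k \<le> n \<Longrightarrow> x \<in> {a..b} \<Longrightarrow> nderiv a b k d x = nderiv a b k f x - nderiv a b k g x"
    unfolding d_def using Cn_on_diff[OF \<open>a < b\<close> f g] by blast+
  have u: "continuous_on {a..b} u"
    using d(1) by (simp add: u_def Cn_on_def)
  have d_eq: "d x = 0 * power_kernel (n - 1) x y +
      (LBINT z=ereal y..ereal x. power_kernel (n - 1) x z * u z)" if "x \<in> {a..b}" for x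
    using taylor_integral_remainder[OF derivative_chain_nderiv[OF d(1)] \<open>n \<ge> 1\<close> _ that y] u d(2) init y
    by (simp add: u_def)
  have "u x = (LBINT z=ereal y..ereal x. h_kernel n P x z * u z)" if x: "x \<in> {a..b}" for x
  proof -
    have "diff_op n P a b d x = diff_op n P a b f x - diff_op n P a b g x"
      using d(2) x by (simp add: diff_op_def right_diff_distrib sum_subtractf)
    then show ?thesis
      using diff_op_power_integral[OF assms(1,2) u y d_eq x, of P] op[OF x] by simp
  qed
  then have "u x = 0" if "x \<in> {a..b}" for x
    by (rule volterra_homogeneous_eq_zero[OF continuous_kernel_h[OF P] u y _ that])
  then have "(LBINT z=ereal y..ereal x. power_kernel (n - 1) x z * u z) = (LBINT z=ereal y..ereal x. 0)"
    by (intro interval_integral_cong_within[OF _ x y]) simp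
  then have "d x = 0"
    using d_eq[OF x] by simp
  then show ?thesis by (simp add: d_def)
qed

text \<open>
  The term with index \<open>r + 2\<close> has \<open>r + 1\<close> integrations, and the separate summand \<open>h\<close> in
  \<^const>\<open>R_kernel\<close> is the term with none; together they exhaust the resolvent series.
\<close>

lemma R_kernel_eq_resolvent:
  assumes P: "\<forall>k<n. continuous_on {a..b} (P k)"
    and "x \<in> {a..b}" "y \<in> {a..b}"
  shows "summable (\<lambda>r. R_term n P (r + 2) x y)"
    and "R_kernel n P x y = resolvent_kernel (h_kernel n P) x y"
proof -
  let ?I = "\<lambda>m. iterated_kernel (h_kernel n P) m x y"
  have s: "summable ?I"
    by (rule iterated_kernel_uniform_limit(2)[OF continuous_kernel_h[OF P] assms(2,3)])
  have R: "R_term n P (r + 2) x y = ?I (Suc r)" for r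
    by (simp add: R_term_def nested_integral_eq_iterated_kernel del: iterated_kernel.simps)
  show "summable (\<lambda>r. R_term n P (r + 2) x y)"
    unfolding R using s by (subst summable_Suc_iff)
  show "R_kernel n P x y = resolvent_kernel (h_kernel n P) x y"
    unfolding R_kernel_def R resolvent_kernel_def using suminf_split_head[OF s] by simp
qed

section \<open>The Green's function and the solution\<close>

lemma T_kernel_eq:
  assumes P: "\<forall>k<n. continuous_on {a..b} (P k)"
    and x: "x \<in> {a..b}" and y: "y \<in> {a..b}"
  shows "T_kernel n P x y = power_kernel (n - 1) x y +
           volterra_product (power_kernel (n - 1)) (resolvent_kernel (h_kernel n P)) x y"
  unfolding T_kernel_def volterra_product_def power_kernel_def[symmetric]
  by (subst interval_integral_cong_within[OF _ x y, where
        g = "\<lambda>z. power_kernel (n - 1) x z * resolvent_kernel (h_kernel n P) z y"])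
     (use R_kernel_eq_resolvent(2)[OF P _ y] in auto)

lemma continuous_kernel_T:
  assumes P: "\<forall>k<n. continuous_on {a..b} (P k)"
  shows "continuous_kernel a b (T_kernel n P)"
proof -
  have "continuous_kernel a b (volterra_product (power_kernel (n - 1)) (resolvent_kernel (h_kernel n P)))"
    by (intro continuous_kernel_volterra_product continuous_kernel_power
        continuous_kernel_resolvent continuous_kernel_h P)
  then have "continuous_on ({a..b} \<times> {a..b}) (\<lambda>p. power_kernel (n - 1) (fst p) (snd p) +
      volterra_product (power_kernel (n - 1)) (resolvent_kernel (h_kernel n P)) (fst p) (snd p))"
    using continuous_kernel_power unfolding continuous_kernel_def case_prod_unfold
    by (intro continuous_on_add)
  then show ?thesis
    unfolding continuous_kernel_def case_prod_unfold
    by (rule continuous_on_eq) (use T_kernel_eq[OF P] in auto)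
qed

text \<open>
  Here \<open>c = 1\<close> and \<open>u\<close> is the resolvent \<open>R\<close> at fixed \<open>y\<close>; the differential equation is then the
  resolvent equation. At \<open>x = y\<close> the integrals vanish and only the weight of degree zero
  survives, which gives the initial values.
\<close>

lemma is_causal_kernel_T:
  assumes "a < b" "n \<ge> 1" and P: "\<forall>k<n. continuous_on {a..b} (P k)"
  shows "is_causal_kernel n P a b (T_kernel n P)"
  unfolding is_causal_kernel_def
proof (intro ballI conjI allI impI)
  let ?h = "h_kernel n P"
  fix y assume y: "y \<in> {a..b}"
  have h: "continuous_kernel a b ?h" by (rule continuous_kernel_h[OF P])
  have u: "continuous_on {a..b} (\<lambda>z. resolvent_kernel ?h z y)"
    by (rule continuous_kernel_sections(2)[OF continuous_kernel_resolvent[OF h] y])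
  have T: "T_kernel n P x y = 1 * power_kernel (n - 1) x y +
      (LBINT z=ereal y..ereal x. power_kernel (n - 1) x z * resolvent_kernel ?h z y)"
    if "x \<in> {a..b}" for x
    using T_kernel_eq[OF P that y] by (simp add: volterra_product_def)
  note d = Cn_on_power_integral[OF assms(1,2) u y T]
  show "Cn_on n a b (\<lambda>x. T_kernel n P x y)"
    by (rule d(1))
  show "diff_op n P a b (\<lambda>x. T_kernel n P x y) x = 0" if x: "x \<in> {a..b}" for x
    using diff_op_power_integral[OF assms(1,2) u y T x] resolvent_equation[OF h x y]
    by (simp add: volterra_product_def)
  show "nderiv a b i (\<lambda>x. T_kernel n P x y) y = 0" if "i < n - 1" for i
  proof -
    have "n - i - 1 = Suc (n - i - 2)" using that by simp
    then show ?thesis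
      using d(3)[of i y] that y by (simp del: diff_diff_left)
  qed
  show "nderiv a b (n - 1) (\<lambda>x. T_kernel n P x y) y = 1"
    using d(3)[of "n - 1" y] \<open>n \<ge> 1\<close> y by simp
qed

lemma causal_kernel_unique:
  assumes "a < b" "n \<ge> 1" and P: "\<forall>k<n. continuous_on {a..b} (P k)"
    and S: "is_causal_kernel n P a b S" and T: "is_causal_kernel n P a b T"
    and "x \<in> {a..b}" "y \<in> {a..b}"
  shows "S x y = T x y"
proof (rule ode_uniqueness[OF assms(1-3), where f = "\<lambda>x. S x y" and g = "\<lambda>x. T x y"])
  show "nderiv a b i (\<lambda>x. S x y) y = nderiv a b i (\<lambda>x. T x y) y" if "i < n" for i
  proof (cases "i < n - 1")
    case False
    then have "i = n - 1" using that by simp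
    then show ?thesis using S T assms(7) by (simp add: is_causal_kernel_def)
  qed (use S T assms(7) in \<open>simp add: is_causal_kernel_def\<close>)
qed (use assms in \<open>auto simp: is_causal_kernel_def\<close>)

text \<open>
  The density \<open>u = g + R g\<close> solves \<open>u = g + h u\<close>, because \<open>h + h \<star> R = R\<close> for the composition
  \<open>\<star>\<close> of kernels. By the same exchange of integrals, integrating \<open>u\<close> against the weight
  \<^term>\<open>power_kernel (n - 1)\<close> produces \<open>T\<close> integrated against \<open>g\<close>.
\<close>

lemma is_solution_T_integral:
  assumes "a < b" "n \<ge> 1" and P: "\<forall>k<n. continuous_on {a..b} (P k)"
    and g: "continuous_on {a..b} g"
    and f: "\<And>x. x \<in> {a..b} \<Longrightarrow> f x = (LBINT z=ereal a..ereal x. T_kernel n P x z * g z)"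
  shows "is_solution n P g a b f"
proof -
  let ?h = "h_kernel n P" and ?p = "power_kernel (n - 1)"
  let ?R = "resolvent_kernel ?h"
  define u where "u w = g w + (LBINT z=ereal a..ereal w. ?R w z * g z)" for w
  have a: "a \<in> {a..b}" using \<open>a < b\<close> by simp
  have p: "continuous_kernel a b ?p" by (rule continuous_kernel_power)
  have h: "continuous_kernel a b ?h" by (rule continuous_kernel_h[OF P])
  have R: "continuous_kernel a b ?R" by (rule continuous_kernel_resolvent[OF h])
  note int = interval_integrable_within[OF continuous_on_mult[OF continuous_kernel_sections(1) g] _ a]
  have Rg: "continuous_on {a..b} (\<lambda>w. LBINT z=ereal a..ereal w. ?R w z * g z)"
  proof -
    have "continuous_kernel a b (\<lambda>z y. g z)"
      unfolding continuous_kernel_def case_prod_unfold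
      by (rule continuous_on_compose2[OF g]) (auto intro: continuous_intros)
    from continuous_kernel_sections(2)[OF continuous_kernel_volterra_product[OF R this] a]
    show ?thesis by (simp add: volterra_product_def)
  qed
  have u: "continuous_on {a..b} u"
    unfolding u_def using g Rg by (rule continuous_on_add)
  have kernel_u: "(LBINT w=ereal a..ereal x. k x w * u w) =
      (LBINT z=ereal a..ereal x. k x z * g z) + (LBINT z=ereal a..ereal x. volterra_product k ?R x z * g z)"
    if k: "continuous_kernel a b k" and x: "x \<in> {a..b}" for k x
  proof -
    have "(LBINT w=ereal a..ereal x. k x w * u w) = (LBINT w=ereal a..ereal x. k x w * g w) +
        (LBINT w=ereal a..ereal x. k x w * (LBINT z=ereal a..ereal w. ?R w z * g z))"
      unfolding u_def distrib_left
      by (intro interval_lebesgue_integral_add interval_integrable_within[OF _ x a]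
          continuous_on_mult continuous_kernel_sections(1)[OF k x] g Rg)
    then show ?thesis
      using volterra_product_assoc[OF k R g x] by simp
  qed
  have f_u: "f x = 0 * ?p x a + (LBINT z=ereal a..ereal x. ?p x z * u z)" if x: "x \<in> {a..b}" for x
  proof -
    have "f x = (LBINT z=ereal a..ereal x. ?p x z * g z + volterra_product ?p ?R x z * g z)"
      unfolding f[OF x]
      by (rule interval_integral_cong_within[OF _ x a]) (use T_kernel_eq[OF P x] in \<open>simp add: distrib_right\<close>)
    also have "\<dots> = (LBINT z=ereal a..ereal x. ?p x z * g z) +
                    (LBINT z=ereal a..ereal x. volterra_product ?p ?R x z * g z)"
      by (intro interval_lebesgue_integral_add int[OF p x x]
          int[OF continuous_kernel_volterra_product[OF p R] x x])
    finally show ?thesis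
      using kernel_u[OF p x] by simp
  qed
  note d = Cn_on_power_integral[OF assms(1,2) u a f_u]
  have "diff_op n P a b f x = g x" if x: "x \<in> {a..b}" for x
  proof -
    have "(LBINT z=ereal a..ereal x. ?h x z * u z) =
          (LBINT z=ereal a..ereal x. ?h x z * g z + volterra_product ?h ?R x z * g z)"
      unfolding kernel_u[OF h x]
      by (intro interval_lebesgue_integral_add(2)[symmetric] int[OF h x x]
          int[OF continuous_kernel_volterra_product[OF h R] x x])
    also have "\<dots> = (LBINT z=ereal a..ereal x. ?R x z * g z)"
      by (rule interval_integral_cong_within[OF _ x a])
         (use resolvent_equation[OF h x] in \<open>simp add: distrib_right\<close>)
    finally show ?thesis
      using diff_op_power_integral[OF assms(1,2) u a f_u x, of P] by (simp add: u_def)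
  qed
  moreover have "nderiv a b i f a = 0" if "i < n" for i
    using d(3)[of i a] that a by simp
  ultimately show ?thesis
    using d(1) by (simp add: is_solution_def)
qed

text \<open>
  The step function cuts the integral off at \<open>x\<close>. Below \<open>x\<close> the integrand is continuous, although
  it may jump at \<open>z = x\<close> when \<open>n = 1\<close>.
\<close>

lemma G_kernel_integral:
  assumes P: "\<forall>k<n. continuous_on {a..b} (P k)" and g: "continuous_on {a..b} g"
    and x: "x \<in> {a..b}"
  shows "interval_lebesgue_integrable lborel (ereal a) (ereal b) (\<lambda>z. G_kernel n P x z * g z)"
    and "(LBINT z=ereal a..ereal b. G_kernel n P x z * g z) =
         (LBINT z=ereal a..ereal x. T_kernel n P x z * g z)"
proof -
  have ab: "a \<le> x" "x \<le> b" "a \<le> b" using x by auto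
  have "set_integrable lborel {a..x} (\<lambda>z. T_kernel n P x z * g z)"
    using continuous_on_mult[OF continuous_kernel_sections(1)[OF continuous_kernel_T[OF P] x] g] ab
    by (intro borel_integrable_atLeastAtMost') (auto intro: continuous_on_subset)
  moreover have *: "indicator {a..b} z *\<^sub>R (G_kernel n P x z * g z) =
      indicator {a..x} z *\<^sub>R (T_kernel n P x z * g z)" for z
    using ab by (auto simp: G_kernel_def heaviside_def indicator_def)
  ultimately have "set_integrable lborel {a..b} (\<lambda>z. G_kernel n P x z * g z)"
    by (simp add: set_integrable_def)
  then show "interval_lebesgue_integrable lborel (ereal a) (ereal b) (\<lambda>z. G_kernel n P x z * g z)"
    using ab by (auto simp: interval_lebesgue_integrable_def elim: set_integrable_subset)
  show "(LBINT z=ereal a..ereal b. G_kernel n P x z * g z) =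
         (LBINT z=ereal a..ereal x. T_kernel n P x z * g z)"
    using ab by (simp add: interval_integral_Icc set_lebesgue_integral_def *)
qed


theorem theorem1:
  fixes n :: nat and a b :: real
    and P :: "nat \<Rightarrow> real \<Rightarrow> complex" and g :: "real \<Rightarrow> complex"
  assumes "n \<ge> 1" and "a < b"
    and "\<And>k. k < n \<Longrightarrow> continuous_on {a..b} (P k)"
    and "continuous_on {a..b} g"
  shows
    "(\<forall>x\<in>{a..b}. \<forall>y\<in>{a..b}.
        summable (\<lambda>r. R_term n P (r + 2) x y) \<and>
        interval_lebesgue_integrable lborel (ereal y) (ereal x)
          (\<lambda>z. complex_of_real ((x - z) ^ (n - 1) / fact (n - 1)) * R_kernel n P z y)) \<and>
     is_causal_kernel n P a b (T_kernel n P) \<and>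
     is_Green_function n P a b (G_kernel n P) \<and>
     (\<forall>G. is_Green_function n P a b G \<longrightarrow>
        (\<forall>x\<in>{a..b}. \<forall>y\<in>{a..b}. G x y = G_kernel n P x y)) \<and>
     (\<forall>x\<in>{a..b}. interval_lebesgue_integrable lborel (ereal a) (ereal b)
        (\<lambda>z. G_kernel n P x z * g z)) \<and>
     is_solution n P g a b (\<lambda>x. LBINT z=ereal a..ereal b. G_kernel n P x z * g z) \<and>
     (\<forall>f. is_solution n P g a b f \<longrightarrow>
        (\<forall>x\<in>{a..b}. f x = (LBINT z=ereal a..ereal b. G_kernel n P x z * g z)))"
proof (intro conjI)
  note n = assms(1) and ab = assms(2) and g = assms(4)
  have P: "\<forall>k<n. continuous_on {a..b} (P k)" using assms(3) by blast
  note T = is_causal_kernel_T[OF ab n P]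
  show "\<forall>x\<in>{a..b}. \<forall>y\<in>{a..b}. summable (\<lambda>r. R_term n P (r + 2) x y) \<and>
      interval_lebesgue_integrable lborel (ereal y) (ereal x)
        (\<lambda>z. complex_of_real ((x - z) ^ (n - 1) / fact (n - 1)) * R_kernel n P z y)"
  proof (intro ballI conjI)
    fix x y assume x: "x \<in> {a..b}" and y: "y \<in> {a..b}"
    show "summable (\<lambda>r. R_term n P (r + 2) x y)"
      by (rule R_kernel_eq_resolvent(1)[OF P x y])
    have "continuous_on {a..b} (\<lambda>z. R_kernel n P z y)"
      using continuous_kernel_sections(2)[OF continuous_kernel_resolvent[OF continuous_kernel_h[OF P]] y]
      by (rule continuous_on_eq) (use R_kernel_eq_resolvent(2)[OF P _ y] in auto)
    then show "interval_lebesgue_integrable lborel (ereal y) (ereal x)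
        (\<lambda>z. complex_of_real ((x - z) ^ (n - 1) / fact (n - 1)) * R_kernel n P z y)"
      unfolding power_kernel_def[symmetric]
      by (intro interval_integrable_within[OF _ x y] continuous_on_mult
          continuous_kernel_sections(1)[OF continuous_kernel_power x])
  qed
  show "is_causal_kernel n P a b (T_kernel n P)"
    by (rule T)
  show "is_Green_function n P a b (G_kernel n P)"
    using T unfolding is_Green_function_def G_kernel_def by (auto simp: mult.commute)
  show "\<forall>G. is_Green_function n P a b G \<longrightarrow>
      (\<forall>x\<in>{a..b}. \<forall>y\<in>{a..b}. G x y = G_kernel n P x y)"
    using causal_kernel_unique[OF ab n P _ T]
    unfolding is_Green_function_def G_kernel_def by (metis mult.commute)
  show "\<forall>x\<in>{a..b}. interval_lebesgue_integrable lborel (ereal a) (ereal b)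
      (\<lambda>z. G_kernel n P x z * g z)"
    using G_kernel_integral(1)[OF P g] by blast
  show sol: "is_solution n P g a b (\<lambda>x. LBINT z=ereal a..ereal b. G_kernel n P x z * g z)"
    by (rule is_solution_T_integral[OF ab n P g G_kernel_integral(2)[OF P g]])
  show "\<forall>f. is_solution n P g a b f \<longrightarrow>
      (\<forall>x\<in>{a..b}. f x = (LBINT z=ereal a..ereal b. G_kernel n P x z * g z))"
  proof (intro allI impI ballI)
    fix f x assume f: "is_solution n P g a b f" and x: "x \<in> {a..b}"
    have a: "a \<in> {a..b}" using ab by simp
    show "f x = (LBINT z=ereal a..ereal b. G_kernel n P x z * g z)"
      by (rule ode_uniqueness[OF ab n P _ _ a _ _ x, of f])
         (use f sol in \<open>auto simp: is_solution_def\<close>)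
  qed
qed

end
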